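(* Let $m$ be a positive integer and $k$ a nonnegative integer. There is a bijection between the set $\mathcal{Q}'(m,k)$ and the set $\mathcal{SD}(2m,2k+1)$.
   Context: For a positive integer $K$ and real $s$, a free ballot $(s,K)$-path of height $n$ is a lattice path from $(0,0)$ to $(s,n)$ with up steps $(K/2,1)$, down steps $(K/2,-1)$ and horizontal steps $(\ell,0)$ ($\ell$ an integer, $1\le\ell<K$), allowed to go below the $x$-axis. $\mathcal{FB}'_n(s,K)$ is the set of such paths whose first step is horizontal or down. $\mathcal{Q}'(m,k)=\bigl(\bigcup_{i=0}^{k-1}\mathcal{FB}'_0(m-i,2k+1)\bigr)\cup\mathcal{FB}'_{-1}(m+\tfrac12,2k+1)$. An $(s,K)$-Dyck path is a free ballot $(s,K)$-path of height $0$ never going below the $x$-axis; it is symmetric if its reflection about the line $x=s/2$ is itself. $\mathcal{SD}(s,K)$ is the set of symmetric $(s,K)$-Dyck paths. *)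

theory Defs
  imports Complex_Main "HOL-Library.Product_Plus"
begin

text \<open>
  A lattice path starting at the origin is represented by the list of its step vectors.
  Abscissae are real because up and down steps have width \<open>K/2\<close>.
  Paths are distinguished by their steps, not by the planar curve they trace: two horizontal steps
  of length 1 differ from one horizontal step of length 2.
\<close>

type_synonym path = "(real \<times> int) list"

definition up_step :: "nat \<Rightarrow> real \<times> int" where
  "up_step K = (real K / 2, 1)"

definition down_step :: "nat \<Rightarrow> real \<times> int" where
  "down_step K = (real K / 2, -1)"

definition horizontal_steps :: "nat \<Rightarrow> (real \<times> int) set" where
  "horizontal_steps K = {(real l, 0) | l. 1 \<le> l \<and> l < K}"

definition vertices :: "path \<Rightarrow> (real \<times> int) list" where
  "vertices p = map (\<lambda>j. sum_list (take j p)) [0..<Suc (length p)]"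

definition free_ballot_paths :: "int \<Rightarrow> real \<Rightarrow> nat \<Rightarrow> path set" where
  "free_ballot_paths n s K =
    {p. set p \<subseteq> {up_step K, down_step K} \<union> horizontal_steps K \<and> sum_list p = (s, n)}"

text \<open>
  The condition on the first step is vacuous for the empty path, which therefore belongs to
  \<open>free_ballot_paths' 0 0 K\<close>.
\<close>

definition free_ballot_paths' :: "int \<Rightarrow> real \<Rightarrow> nat \<Rightarrow> path set" where
  "free_ballot_paths' n s K =
    {p \<in> free_ballot_paths n s K. p \<noteq> [] \<longrightarrow> hd p \<in> horizontal_steps K \<union> {down_step K}}"

definition Q' :: "nat \<Rightarrow> nat \<Rightarrow> path set" where
  "Q' m k =
    (\<Union>i\<in>{0..<k}. free_ballot_paths' 0 (real m - real i) (2 * k + 1)) \<union>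
    free_ballot_paths' (-1) (real m + 1 / 2) (2 * k + 1)"

definition dyck_paths :: "real \<Rightarrow> nat \<Rightarrow> path set" where
  "dyck_paths s K = {p \<in> free_ballot_paths 0 s K. \<forall>(x, y) \<in> set (vertices p). 0 \<le> y}"

text \<open>
  The reflection about the vertical line at \<open>s/2\<close> sends \<open>(x, y)\<close> to \<open>(s - x, y)\<close>; the image of a
  path is traversed in the opposite direction, so that it again runs from left to right.
\<close>

definition symmetric_path :: "real \<Rightarrow> path \<Rightarrow> bool" where
  "symmetric_path s p \<longleftrightarrow> rev (map (\<lambda>(x, y). (s - x, y)) (vertices p)) = vertices p"

definition SD :: "real \<Rightarrow> nat \<Rightarrow> path set" where
  "SD s K = {p \<in> dyck_paths s K. symmetric_path s p}"

end

theory Submission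
  imports Defs
begin

text \<open>
  A symmetric path is determined by its first half \<open>q\<close> and the length \<open>l\<close> of the horizontal step
  crossing the axis of symmetry (\<open>l = 0\<close> if there is none). The half \<open>q\<close> is a nonnegative path with
  arbitrary final height, ending at abscissa \<open>m - l/2\<close>. Trading up steps against down steps turns
  nonnegative paths into free paths of final height \<open>0\<close> or \<open>-1\<close>, and the parity of \<open>l\<close> tells which.
  Write \<open>h j\<close> for the horizontal step of length \<open>j\<close>. A free path of height \<open>0\<close> with \<open>l = 2i < 2k\<close> is
  kept unless it is \<open>up # r\<close>, which becomes \<open>h (i + k + 1) # r\<close>; if \<open>l = 2k\<close>, a down step is
  prepended; a path of height \<open>-1\<close> with \<open>l = 2j - 1\<close> gets \<open>h j\<close> prepended.
\<close>

section \<open>Steps, heights and mirror images\<close>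

abbreviation steps :: "nat \<Rightarrow> (real \<times> int) set" where
  "steps K \<equiv> {up_step K, down_step K} \<union> horizontal_steps K"

abbreviation height :: "path \<Rightarrow> int" where
  "height p \<equiv> snd (sum_list p)"

abbreviation width :: "path \<Rightarrow> real" where
  "width p \<equiv> fst (sum_list p)"

text \<open>Reflection about a vertical line, followed by reversal of the direction of travel, at
  the level of steps: the order is reversed, widths stay, vertical components change sign.\<close>

definition mirror :: "path \<Rightarrow> path" where
  "mirror p = rev (map (\<lambda>(x, y). (x, - y)) p)"

lemma mirror_Nil [simp]: "mirror [] = []"
  by (simp add: mirror_def)

lemma mirror_Cons [simp]: "mirror (x # p) = mirror p @ [(fst x, - snd x)]"
  by (simp add: mirror_def case_prod_beta)

lemma mirror_append [simp]: "mirror (p @ q) = mirror q @ mirror p"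
  by (induction p) auto

lemma mirror_mirror [simp]: "mirror (mirror p) = p"
  by (induction p) auto

lemma length_mirror [simp]: "length (mirror p) = length p"
  by (simp add: mirror_def)

lemma width_mirror [simp]: "width (mirror p) = width p"
  by (induction p) auto

lemma height_mirror [simp]: "height (mirror p) = - height p"
  by (induction p) auto

lemma set_mirror_subset: "set p \<subseteq> steps K \<Longrightarrow> set (mirror p) \<subseteq> steps K"
  by (induction p) (auto simp: up_step_def down_step_def horizontal_steps_def)

section \<open>Vertices and reflection symmetry\<close>

lemma vertices_Nil [simp]: "vertices [] = [0]"
  by (simp add: vertices_def)

lemma vertices_Cons [simp]: "vertices (x # p) = 0 # map ((+) x) (vertices p)"
proof -
  have "[0..<Suc (length (x # p))] = 0 # map Suc [0..<Suc (length p)]"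
    by (metis length_Cons map_Suc_upt upt_conv_Cons zero_less_Suc)
  then show ?thesis
    by (simp only: vertices_def) simp
qed

lemma vertices_snoc: "vertices (p @ [x]) = vertices p @ [sum_list p + x]"
  by (induction p) (auto simp: add.assoc)

text \<open>Every vertex list starts at the origin, so comparing heads of the translated tails
  yields the first step, and the translation then cancels.\<close>

lemma vertices_inject: "vertices p = vertices q \<Longrightarrow> p = q"
proof (induction p arbitrary: q)
  case Nil
  then show ?case
    by (cases q; cases "tl q") auto
next
  case (Cons x p)
  then obtain y q' where q: "q = y # q'"
    by (cases q; cases p) auto
  have eq: "map ((+) x) (vertices p) = map ((+) y) (vertices q')"
    using Cons.prems q by simp
  have "hd (vertices r) = 0" "vertices r \<noteq> []" for r
    by (cases r; simp)+
  then have "x = y"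
    using arg_cong[OF eq, of hd] by (simp add: hd_map)
  moreover from this eq have "vertices p = vertices q'"
    by (simp add: inj_map_eq_map inj_def)
  ultimately show ?case
    using Cons.IH q by simp
qed

text \<open>The reflected vertices, read backwards, are those of the mirror image started at the
  reflected endpoint. The offset \<open>c\<close> is general because each step consumed by the
  induction shifts it.\<close>

lemma rev_map_reflect_vertices:
  "rev (map (\<lambda>v. (fst c - fst v, snd c + snd v)) (vertices p)) =
    map ((+) (fst c - width p, snd c + height p)) (vertices (mirror p))"
proof (induction p arbitrary: c)
  case Nil
  then show ?case
    by simp
next
  case (Cons x p)
  have "(\<lambda>v. (fst c - fst v, snd c + snd v)) \<circ> (+) x =
      (\<lambda>v. (fst (fst c - fst x, snd c + snd x) - fst v, snd (fst c - fst x, snd c + snd x) + snd v))"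
    by (auto simp: fun_eq_iff)
  then show ?case
    using Cons.IH[of "(fst c - fst x, snd c + snd x)"]
    by (simp add: vertices_snoc prod_eq_iff diff_diff_eq add.assoc)
qed

text \<open>For a path ending at \<open>(s, 0)\<close> the translation in the reflection lemma
  vanishes, so symmetry compares \<open>vertices (mirror p)\<close> with
  \<open>vertices p\<close>.\<close>

lemma symmetric_path_iff:
  assumes "sum_list p = (s, 0)"
  shows "symmetric_path s p \<longleftrightarrow> mirror p = p"
proof -
  have "rev (map (\<lambda>(x, y). (s - x, y)) (vertices p)) = vertices (mirror p)"
    using rev_map_reflect_vertices[of "(s, 0)" p] assms
    by (simp add: case_prod_unfold map_idI flip: zero_prod_def)
  then show ?thesis
    using vertices_inject by (auto simp: symmetric_path_def)
qed

section \<open>Staying above the axis\<close>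

fun above_axis :: "int \<Rightarrow> path \<Rightarrow> bool" where
  "above_axis d [] \<longleftrightarrow> 0 \<le> d"
| "above_axis d (x # p) \<longleftrightarrow> 0 \<le> d \<and> above_axis (d + snd x) p"

lemma above_axisD: "above_axis d p \<Longrightarrow> 0 \<le> d"
  by (cases p) auto

lemma above_axis_append:
  "above_axis d (p @ q) \<longleftrightarrow> above_axis d p \<and> above_axis (d + height p) q"
  by (induction p arbitrary: d) (auto simp: add.assoc dest: above_axisD)

text \<open>The mirror image, started at the final height of \<open>p\<close>, visits the same
  heights in reverse order.\<close>

lemma above_axis_mirror: "above_axis (d + height p) (mirror p) \<longleftrightarrow> above_axis d p"
  using above_axisD
  by (induction p arbitrary: d) (auto simp: above_axis_append simp flip: add.assoc)

lemma above_axis_iff: "above_axis d p \<longleftrightarrow> (\<forall>(x, y) \<in> set (vertices p). 0 \<le> d + y)"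
  by (induction p arbitrary: d) (auto simp: case_prod_beta add.assoc)

lemma SD_iff:
  "p \<in> SD s K \<longleftrightarrow> set p \<subseteq> steps K \<and> sum_list p = (s, 0) \<and> above_axis 0 p \<and> mirror p = p"
  using symmetric_path_iff
  by (auto simp: SD_def dyck_paths_def free_ballot_paths_def above_axis_iff)

section \<open>Cutting symmetric paths in half\<close>

definition half_paths :: "nat \<Rightarrow> nat \<Rightarrow> (nat \<times> path) set" where
  "half_paths m K =
    {(l, q). l < K \<and> set q \<subseteq> steps K \<and> width q = real m - real l / 2 \<and> above_axis 0 q}"

definition middle :: "nat \<Rightarrow> path" where
  "middle l = (if l = 0 then [] else [(real l, 0)])"

lemma middle_simps [simp]:
  "mirror (middle l) = middle l" "width (middle l) = real l" "height (middle l) = 0"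
  "above_axis d (middle l) \<longleftrightarrow> 0 \<le> d"
  by (auto simp: middle_def)

text \<open>The mirror exchanges first and last step, so both can be stripped from an invariant
  path; at most one step remains in the centre.\<close>

lemma mirror_eq_selfE:
  assumes "mirror p = p"
  obtains q r where "p = q @ r @ mirror q" "length r \<le> 1" "mirror r = r"
proof -
  have "\<exists>q r. p = q @ r @ mirror q \<and> length r \<le> 1 \<and> mirror r = r"
    using assms
  proof (induction "length p" arbitrary: p rule: less_induct)
    case less
    show ?case
    proof (cases "length p \<le> 1")
      case True
      then show ?thesis
        using less.prems by (intro exI[of _ "[]"] exI[of _ p]) auto
    next
      case False
      then obtain x p' where "p = x # p'" "p' \<noteq> []"
        by (cases p) auto
      then obtain y p'' where p: "p = x # p'' @ [y]"
        by (metis append_butlast_last_id)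
      have p'': "mirror p'' = p''" and y: "y = (fst x, - snd x)"
        using less.prems unfolding p by simp_all
      have "length p'' < length p"
        by (simp add: p)
      then obtain q r where qr: "p'' = q @ r @ mirror q" "length r \<le> 1" "mirror r = r"
        using less.hyps p'' by blast
      have "p = (x # q) @ r @ mirror (x # q)"
        by (simp add: p qr(1) y)
      with qr(2,3) show ?thesis
        by blast
    qed
  qed
  with that show thesis
    by blast
qed

lemma bij_betw_half_paths_SD:
  assumes "K > 0"
  shows "bij_betw (\<lambda>(l, q). q @ middle l @ mirror q) (half_paths m K) (SD (2 * real m) K)"
  unfolding bij_betw_def
proof
  show "inj_on (\<lambda>(l, q). q @ middle l @ mirror q) (half_paths m K)"
  proof (rule inj_onI, clarify)
    fix l q l' q'
    assume eq: "q @ middle l @ mirror q = q' @ middle l' @ mirror q'"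
    then have len: "2 * length q + length (middle l) = 2 * length q' + length (middle l')"
      by (auto dest: arg_cong[of _ _ length])
    \<comment> \<open>Lengths at most 1 are fixed by the parity of the total length, which then
      fixes the length of the half.\<close>
    have "length (middle l) \<le> 1" "length (middle l') \<le> 1"
      by (auto simp: middle_def)
    with len have "length q = length q'"
      by linarith
    with eq have "q = q'" "middle l = middle l'"
      by auto
    then show "l = l' \<and> q = q'"
      by (auto simp: middle_def split: if_splits)
  qed
  show "(\<lambda>(l, q). q @ middle l @ mirror q) ` half_paths m K = SD (2 * real m) K"
  proof (intro equalityI subsetI)
    fix p assume "p \<in> (\<lambda>(l, q). q @ middle l @ mirror q) ` half_paths m K"
    then obtain l q where p: "p = q @ middle l @ mirror q" and "(l, q) \<in> half_paths m K"
      by auto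
    then have lq: "l < K" "set q \<subseteq> steps K" "width q = real m - real l / 2" "above_axis 0 q"
      by (auto simp: half_paths_def)
    have "set (middle l) \<subseteq> steps K"
      using lq(1) by (auto simp: middle_def horizontal_steps_def)
    with lq set_mirror_subset[OF lq(2)] have "set p \<subseteq> steps K"
      by (auto simp: p)
    moreover have "above_axis 0 p"
      using lq(4) above_axis_mirror[of 0 q] above_axisD[of "height q" "mirror q"]
      by (simp add: p above_axis_append)
    ultimately show "p \<in> SD (2 * real m) K"
      using lq(3) by (auto simp: SD_iff p prod_eq_iff)
  next
    fix p assume "p \<in> SD (2 * real m) K"
    then have st: "set p \<subseteq> steps K" and sm: "sum_list p = (2 * real m, 0)"
      and above: "above_axis 0 p" and mir: "mirror p = p"
      unfolding SD_iff by blast+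
    obtain q r where p: "p = q @ r @ mirror q" and r: "length r \<le> 1" "mirror r = r"
      by (rule mirror_eq_selfE[OF mir])
    have "\<exists>l<K. r = middle l"
    proof (cases r)
      case Nil
      \<comment> \<open>The witness is \<open>l = 0\<close>, which is below \<open>K\<close> since
        \<open>K\<close> is positive.\<close>
      with assms show ?thesis
        by (auto simp: middle_def)
    next
      case (Cons x r')
      \<comment> \<open>Invariance gives \<open>snd x = - snd x\<close>, so the central step is
        neither up nor down.\<close>
      then have x: "r = [x]" "snd x = 0"
        using r by (auto simp: prod_eq_iff)
      moreover have "x \<in> steps K"
        using st by (simp add: p x)
      ultimately obtain l where "x = (real l, 0)" "1 \<le> l" "l < K"
        by (auto simp: up_step_def down_step_def horizontal_steps_def)
      then show ?thesis
        using x by (auto simp: middle_def intro!: exI[of _ l])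
    qed
    then obtain l where l: "l < K" "r = middle l"
      by auto
    have "(l, q) \<in> half_paths m K"
      using l st sm above by (auto simp: half_paths_def p above_axis_append prod_eq_iff)
    then show "p \<in> (\<lambda>(l, q). q @ middle l @ mirror q) ` half_paths m K"
      using p l by force
  qed
qed

section \<open>Trading up steps for down steps\<close>

text \<open>
  Reading a path from its end, \<open>to_free\<close> turns an up step into a down step whenever the remainder,
  already treated, has height at least the current height \<open>d\<close>. The paths staying above the axis
  when started at height \<open>d\<close> thereby correspond to the paths with final height in
  \<open>{- d - 1..d}\<close>.
\<close>

fun to_free :: "nat \<Rightarrow> int \<Rightarrow> path \<Rightarrow> path" where
  "to_free K d [] = []"
| "to_free K d (x # p) =
    (let q = to_free K (d + snd x) p
     in if x = up_step K \<and> d \<le> height q then down_step K # q else x # q)"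

text \<open>The test sees the same treated remainder as \<open>to_free\<close> did. After an
  original down step that remainder has height at most \<open>d - 1\<close>, so a down step with
  \<open>d \<le> height q\<close> must come from an up step.\<close>

fun of_free :: "nat \<Rightarrow> int \<Rightarrow> path \<Rightarrow> path" where
  "of_free K d [] = []"
| "of_free K d (x # q) =
    (if x = down_step K \<and> d \<le> height q then up_step K # of_free K (d + 1) q
     else x # of_free K (d + snd x) q)"

lemma up_step_neq_down_step [simp]: "up_step K \<noteq> down_step K" "down_step K \<noteq> up_step K"
  by (simp_all add: up_step_def down_step_def)

lemma step_simps [simp]:
  "fst (up_step K) = real K / 2" "snd (up_step K) = 1"
  "fst (down_step K) = real K / 2" "snd (down_step K) = - 1"
  by (simp_all add: up_step_def down_step_def)

lemma horizontal_neq_step [simp]: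
  "(a, 0) \<noteq> up_step K" "up_step K \<noteq> (a, 0)" "(a, 0) \<noteq> down_step K" "down_step K \<noteq> (a, 0)"
  by (simp_all add: up_step_def down_step_def)

lemma steps_cases:
  assumes "x \<in> steps K"
  obtains "x = up_step K" | "x = down_step K" | j where "x = (real j, 0)" "1 \<le> j" "j < K"
  using assms by (auto simp: horizontal_steps_def)

text \<open>After an up step the treated remainder has height in \<open>{- d - 2..d + 1}\<close>.
  Heights \<open>d\<close> and \<open>d + 1\<close> are exactly those that a further up step would
  push above \<open>d\<close>; a down step brings them to \<open>d - 1\<close> and
  \<open>d\<close>.\<close>

lemma to_free_props:
  assumes "set p \<subseteq> steps K" "above_axis d p"
  shows "set (to_free K d p) \<subseteq> steps K \<and> width (to_free K d p) = width p \<and>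
    height (to_free K d p) \<in> {- d - 1..d} \<and> of_free K d (to_free K d p) = p"
  using assms
proof (induction p arbitrary: d)
  case Nil
  then show ?case
    by simp
next
  case (Cons x p)
  obtain q where eq: "to_free K (d + snd x) p = q"
    by simp
  then have q: "set q \<subseteq> steps K" "width q = width p"
    "height q \<in> {- (d + snd x) - 1..d + snd x}" "of_free K (d + snd x) q = p"
    using Cons.IH[of "d + snd x"] Cons.prems by auto
  have x: "x \<in> steps K" and "0 \<le> d"
    using Cons.prems by simp_all
  from x show ?case
    using q eq x \<open>0 \<le> d\<close>
    by (cases rule: steps_cases) (auto simp: Let_def)
qed

text \<open>The range \<open>{- d - 1..d}\<close> is empty for negative \<open>d\<close>, so the
  height hypothesis itself keeps the restored path above the axis. For an unchanged down step the
  remainder lies in the range for \<open>d - 1\<close>; for a restored up step, in that for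
  \<open>d + 1\<close>.\<close>

lemma of_free_props:
  assumes "set q \<subseteq> steps K" "height q \<in> {- d - 1..d}"
  shows "set (of_free K d q) \<subseteq> steps K \<and> width (of_free K d q) = width q \<and>
    above_axis d (of_free K d q) \<and> to_free K d (of_free K d q) = q"
  using assms
proof (induction q arbitrary: d)
  case Nil
  then show ?case
    by simp
next
  case (Cons x q)
  have "x \<in> steps K" "set q \<subseteq> steps K"
    using Cons.prems by simp_all
  then show ?case
    using Cons.prems Cons.IH[of "d + 1"] Cons.IH[of "d - 1"] Cons.IH[of d]
    by (cases rule: steps_cases) (auto simp: Let_def)
qed

definition half_free_paths :: "nat \<Rightarrow> nat \<Rightarrow> (nat \<times> path) set" where
  "half_free_paths m K =
    {(l, q). l < K \<and> set q \<subseteq> steps K \<and> width q = real m - real l / 2 \<and> height q \<in> {-1, 0}}"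

lemma bij_betw_half_free_paths_half_paths:
  "bij_betw (\<lambda>(l, q). (l, of_free K 0 q)) (half_free_paths m K) (half_paths m K)"
proof (rule bij_betw_byWitness[where f' = "\<lambda>(l, q). (l, to_free K 0 q)"])
  \<comment> \<open>The final heights allowed here are the range of the two preceding lemmas at
    \<open>d = 0\<close>.\<close>
  have eq: "{-1, 0} = {- 0 - 1..0::int}"
    by auto
  show "\<forall>a\<in>half_free_paths m K. (\<lambda>(l, q). (l, to_free K 0 q)) ((\<lambda>(l, q). (l, of_free K 0 q)) a) = a"
    "(\<lambda>(l, q). (l, of_free K 0 q)) ` half_free_paths m K \<subseteq> half_paths m K"
    using of_free_props[of _ K 0] unfolding half_free_paths_def half_paths_def eq by auto
  show "\<forall>a\<in>half_paths m K. (\<lambda>(l, q). (l, of_free K 0 q)) ((\<lambda>(l, q). (l, to_free K 0 q)) a) = a"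
    "(\<lambda>(l, q). (l, to_free K 0 q)) ` half_paths m K \<subseteq> half_free_paths m K"
    using to_free_props[of _ K 0] unfolding half_free_paths_def half_paths_def eq by auto
qed

section \<open>Parity of the middle step\<close>

lemma width_integral:
  assumes "set p \<subseteq> steps K"
  shows "\<exists>z::int. width p = real_of_int z + real K / 2 * real_of_int (height p)"
  using assms
proof (induction p)
  case Nil
  then show ?case
    by simp
next
  case (Cons x p)
  then obtain z :: int where z: "width p = real_of_int z + real K / 2 * real_of_int (height p)"
    by auto
  have "x \<in> steps K"
    using Cons.prems by simp
  then show ?case
  proof (cases rule: steps_cases)
    case 1
    then show ?thesis
      using z by (intro exI[of _ z]) (simp add: field_simps)
  next
    case 2
    \<comment> \<open>A down step adds \<open>K / 2\<close> to the width but subtracts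
      \<open>K / 2\<close> from the height term, so the integer part grows by
      \<open>K\<close>.\<close>
    then show ?thesis
      using z by (intro exI[of _ "z + int K"]) (simp add: field_simps)
  next
    case (3 j)
    then show ?thesis
      using z by (intro exI[of _ "z + int j"]) simp
  qed
qed

text \<open>Since \<open>K\<close> is odd, \<open>width_integral\<close> makes \<open>l\<close> even
  for final height 0 and odd for final height -1.\<close>

lemma half_free_paths_iff:
  "(l, q) \<in> half_free_paths m (Suc (2 * k)) \<longleftrightarrow>
    set q \<subseteq> steps (Suc (2 * k)) \<and>
    ((\<exists>i\<le>k. l = 2 * i \<and> sum_list q = (real m - real i, 0)) \<or>
     (\<exists>j\<in>{1..k}. l = 2 * j - 1 \<and> sum_list q = (real m + 1 / 2 - real j, - 1)))"
  (is "_ \<longleftrightarrow> ?S \<and> (?E \<or> ?O)")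
proof
  assume "(l, q) \<in> half_free_paths m (Suc (2 * k))"
  then have S: ?S and l: "l \<le> 2 * k" and w: "width q = real m - real l / 2" and h: "height q \<in> {-1, 0}"
    by (auto simp: half_free_paths_def)
  obtain z :: int where z: "width q = real_of_int z + real (Suc (2 * k)) / 2 * real_of_int (height q)"
    using width_integral[OF S] by blast
  show "?S \<and> (?E \<or> ?O)"
  proof (cases "height q = 0")
    case True
    then have "real_of_int (int l) = real_of_int (2 * (int m - z))"
      using w z by simp
    then have "int l = 2 * (int m - z)"
      by (simp only: of_int_eq_iff)
    then have "even l"
      by presburger
    then obtain i where "l = 2 * i"
      by blast
    then show ?thesis
      using S l w True by (auto simp: prod_eq_iff)
  next
    case False
    then have h: "height q = - 1"
      using h by simp
    then have "real_of_int (int l) = real_of_int (2 * (int m - z + int k) + 1)"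
      using w z by (simp add: field_simps)
    then have "int l = 2 * (int m - z + int k) + 1"
      by (simp only: of_int_eq_iff)
    then have "odd l"
      by presburger
    then obtain i where "l = 2 * i + 1"
      using oddE by blast
    then have ?O
      using l w h by (intro bexI[of _ "i + 1"]) (auto simp: prod_eq_iff field_simps)
    then show ?thesis
      using S by blast
  qed
qed (auto simp: half_free_paths_def of_nat_diff field_simps)

section \<open>Bijection with \<open>Q'\<close>\<close>

definition to_Q :: "nat \<Rightarrow> nat \<times> path \<Rightarrow> path" where
  "to_Q k = (\<lambda>(l, q).
    if l = 2 * k then down_step (Suc (2 * k)) # q
    else if odd l then (real ((l + 1) div 2), 0) # q
    else if q \<noteq> [] \<and> hd q = up_step (Suc (2 * k)) then (real (Suc (l div 2 + k)), 0) # tl q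
    else q)"

text \<open>At height 0 the missing width is \<open>l / 2\<close>. At height -1 the first step
  identifies the case: down for \<open>l = 2 * k\<close>, horizontal lengths \<open>1..k\<close> for
  odd \<open>l\<close>, lengths \<open>k + 1..2 * k\<close> for a replaced up step.\<close>

definition of_Q :: "nat \<Rightarrow> nat \<Rightarrow> path \<Rightarrow> nat \<times> path" where
  "of_Q m k p =
    (if height p = 0 then (2 * nat \<lfloor>real m - width p\<rfloor>, p)
     else if hd p = down_step (Suc (2 * k)) then (2 * k, tl p)
     else let j = nat \<lfloor>fst (hd p)\<rfloor>
       in if j \<le> k then (2 * j - 1, tl p) else (2 * (j - k - 1), up_step (Suc (2 * k)) # tl p))"

lemma Q'_iff:
  "p \<in> Q' m k \<longleftrightarrow> set p \<subseteq> steps (Suc (2 * k)) \<and> (p \<noteq> [] \<longrightarrow> hd p \<noteq> up_step (Suc (2 * k))) \<and>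
    ((\<exists>i<k. sum_list p = (real m - real i, 0)) \<or> sum_list p = (real m + 1 / 2, - 1))"
proof -
  have "up_step K \<notin> horizontal_steps K" for K
    by (auto simp: up_step_def horizontal_steps_def)
  then show ?thesis
    by (cases p) (auto simp: Q'_def free_ballot_paths'_def free_ballot_paths_def)
qed

lemma to_Q_props:
  assumes "a \<in> half_free_paths m (Suc (2 * k))"
  shows "to_Q k a \<in> Q' m k \<and> of_Q m k (to_Q k a) = a"
proof -
  obtain l q where a: "a = (l, q)"
    by fastforce
  let ?K = "Suc (2 * k)"
  have S: "set q \<subseteq> steps ?K"
    using assms unfolding a half_free_paths_iff by blast
  consider i where "i < k" "l = 2 * i" "sum_list q = (real m - real i, 0)"
    | "l = 2 * k" "sum_list q = (real m - real k, 0)"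
    | j where "1 \<le> j" "j \<le> k" "l = 2 * j - 1" "sum_list q = (real m + 1 / 2 - real j, - 1)"
    using assms unfolding a half_free_paths_iff by (auto simp: le_less)
  then show ?thesis
  proof cases
    case 1
    show ?thesis
    proof (cases "q \<noteq> [] \<and> hd q = up_step ?K")
      case True
      then obtain r where q: "q = up_step ?K # r"
        by (cases q) auto
      \<comment> \<open>Replacing the up step by length \<open>i + k + 1\<close> adds
        \<open>i + 1 / 2\<close> to the width and lowers the height by 1, giving endpoint
        \<open>(m + 1 / 2, - 1)\<close>.\<close>
      have r: "sum_list r = (real m - real i - real ?K / 2, - 1)"
        using 1(3) by (auto simp: q prod_eq_iff)
      have "to_Q k a = (real (Suc (i + k)), 0) # r"
        using 1 by (auto simp: to_Q_def a q)
      moreover have "(real (Suc (i + k)), 0) \<in> horizontal_steps ?K"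
        using 1(1) unfolding horizontal_steps_def by (intro CollectI exI[of _ "Suc (i + k)"]) auto
      moreover have "nat \<lfloor>real (Suc (i + k))\<rfloor> = Suc (i + k)"
        by linarith
      ultimately show ?thesis
        using S r 1(2)
        by (auto simp: Q'_iff of_Q_def a q field_simps Let_def)
    next
      case False
      then have "to_Q k a = q"
        using 1 by (auto simp: to_Q_def a)
      then show ?thesis
        using 1 False S by (auto simp: Q'_iff of_Q_def a)
    qed
  next
    case 2
    then have "sum_list (down_step ?K # q) = (real m + 1 / 2, - 1)"
      by (simp add: prod_eq_iff field_simps)
    then show ?thesis
      using 2 S by (auto simp: to_Q_def Q'_iff of_Q_def a)
  next
    case 3
    have l: "l \<noteq> 2 * k" "odd l" "(l + 1) div 2 = j"
      using 3 by auto
    then have "to_Q k a = (real j, 0) # q"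
      by (simp add: to_Q_def a)
    moreover have "(real j, 0) \<in> horizontal_steps ?K"
      using 3 by (auto simp: horizontal_steps_def)
    ultimately show ?thesis
      using S 3 by (auto simp: Q'_iff of_Q_def a)
  qed
qed

lemma of_Q_props:
  assumes "p \<in> Q' m k"
  shows "of_Q m k p \<in> half_free_paths m (Suc (2 * k)) \<and> to_Q k (of_Q m k p) = p"
proof -
  let ?K = "Suc (2 * k)"
  have S: "set p \<subseteq> steps ?K" and hd: "p \<noteq> [] \<longrightarrow> hd p \<noteq> up_step ?K"
    using assms by (auto simp: Q'_iff)
  consider i where "i < k" "sum_list p = (real m - real i, 0)"
    | "sum_list p = (real m + 1 / 2, - 1)"
    using assms by (auto simp: Q'_iff)
  then show ?thesis
  proof cases
    case 1
    then have "of_Q m k p = (2 * i, p)"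
      by (simp add: of_Q_def)
    then show ?thesis
      using 1 S hd by (auto simp: half_free_paths_iff to_Q_def)
  next
    case 2
    \<comment> \<open>Height -1 excludes the empty path.\<close>
    then obtain x r where p: "p = x # r"
      by (cases p) (auto simp: zero_prod_def)
    have "x \<in> steps ?K" "set r \<subseteq> steps ?K" "x \<noteq> up_step ?K"
      using S hd by (auto simp: p)
    then show ?thesis
    proof (cases rule: steps_cases)
      case x: 2
      then have "sum_list r = (real m - real k, 0)"
        using 2 by (auto simp: p prod_eq_iff)
      then show ?thesis
        using 2 x \<open>set r \<subseteq> _\<close> by (auto simp: p of_Q_def half_free_paths_iff to_Q_def)
    next
      case (3 j)
      have r: "sum_list r = (real m + 1 / 2 - real j, - 1)"
        using 2 3 by (auto simp: p prod_eq_iff)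
      show ?thesis
      proof (cases "j \<le> k")
        case True
        then have "of_Q m k p = (2 * j - 1, r)"
          using 2 3 by (simp add: p of_Q_def)
        moreover have "2 * j - 1 \<noteq> 2 * k" "odd (2 * j - 1)" "(2 * j - 1 + 1) div 2 = j"
          using \<open>1 \<le> j\<close> True by auto
        ultimately show ?thesis
          using True r 3 \<open>set r \<subseteq> _\<close> by (auto simp: p half_free_paths_iff to_Q_def)
      next
        case False
        \<comment> \<open>Lengths above \<open>k\<close> encode a removed up step;
          \<open>j < 2 * k + 1\<close> yields \<open>i < k\<close>.\<close>
        then obtain i where i: "j = Suc (i + k)"
          using less_imp_Suc_add[of k j] by (auto simp: add.commute)
        then have "i < k"
          using 3 by simp
        have "of_Q m k p = (2 * (j - k - 1), up_step ?K # r)"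
          using 2 3(1) False by (simp add: p of_Q_def)
        then have "of_Q m k p = (2 * i, up_step ?K # r)"
          by (simp add: i)
        moreover have "sum_list (up_step ?K # r) = (real m - real i, 0)"
          using r by (simp add: i prod_eq_iff field_simps)
        ultimately show ?thesis
          using 3(1) i \<open>i < k\<close> \<open>set r \<subseteq> _\<close>
          by (auto simp: p half_free_paths_iff to_Q_def)
      qed
    qed simp
  qed
qed

lemma bij_betw_to_Q: "bij_betw (to_Q k) (half_free_paths m (Suc (2 * k))) (Q' m k)"
proof (rule bij_betw_byWitness[where f' = "of_Q m k"])
  show "\<forall>a\<in>half_free_paths m (Suc (2 * k)). of_Q m k (to_Q k a) = a"
    "to_Q k ` half_free_paths m (Suc (2 * k)) \<subseteq> Q' m k"
    using to_Q_props by blast+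
  show "\<forall>p\<in>Q' m k. to_Q k (of_Q m k p) = p"
    "of_Q m k ` Q' m k \<subseteq> half_free_paths m (Suc (2 * k))"
    using of_Q_props by blast+
qed

theorem theorem2p26:
  fixes m k :: nat
  assumes "m \<ge> 1"
  shows "\<exists>f. bij_betw f (Q' m k) (SD (2 * real m) (2 * k + 1))"
proof -
  let ?K = "Suc (2 * k)"
  \<comment> \<open>\<open>to_Q\<close> maps into \<open>Q'\<close>, so its inverse starts the
    chain; restoring nonnegative halves and doubling them follow.\<close>
  have "bij_betw (inv_into (half_free_paths m ?K) (to_Q k)) (Q' m k) (half_free_paths m ?K)"
    by (rule bij_betw_inv_into[OF bij_betw_to_Q])
  from bij_betw_trans[OF bij_betw_trans[OF this bij_betw_half_free_paths_half_paths]
      bij_betw_half_paths_SD[OF zero_less_Suc]]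
  show ?thesis
    unfolding Suc_eq_plus1 by blast
qed

end
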